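(* Let $\mathcal{S}_Z=((X,d),(f_i)_{i\in I},(\rho_i)_{i\in I})$ be an orbital fuzzy iterated function system and let $u\in\mathcal{F}_{\mathcal{S}}^{\ast}$. Then $$\mathbf{u}_u=\bigvee_{x\in[u]^{\ast}}\mathbf{u}_x=\bigvee_{x\in[u]^{1}}\mathbf{u}_x=\max_{x\in[u]^{\ast}}\mathbf{u}_x=\max_{x\in[u]^{1}}\mathbf{u}_x,$$ where $\bigvee$ denotes the pointwise supremum and writing $\max$ means that, at every point of $X$, the pointwise supremum over the indicated index set is attained.
   Context: An orbital fuzzy iterated function system $\mathcal{S}_Z=((X,d),(f_i)_{i\in I},(\rho_i)_{i\in I})$ consists of: a complete metric space $(X,d)$; a finite family of continuous functions $f_i:X\to X$, $i\in I$, for which there exists $C\in[0,1)$ such that $d(f_i(y),f_i(z))\le C\,d(y,z)$ for every $i\in I$, $x\in X$ and $y,z\in\mathcal{O}(x)$, where $\mathcal{O}(x)=\{x\}\cup\{(f_{\omega_1}\circ\cdots\circ f_{\omega_n})(x)\mid n\in\mathbb{N},\ \omega_1,\dots,\omega_n\in I\}$ is the orbit of $x$ ($\mathbb{N}=\{1,2,\dots\}$); and functions $\rho_i:[0,1]\to[0,1]$, $i\in I$, not identically zero, such that each $\rho_i$ is nondecreasing and right continuous with $\rho_i(0)=0$, and there exists $j\in I$ with $\rho_j(1)=1$. For $u:X\to[0,1]$ put $[u]^{\alpha}=\{x\in X\mid u(x)\ge\alpha\}$ for $\alpha\in(0,1]$, $[u]^{\ast}=\{x\in X\mid u(x)>0\}$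 and $[u]^0=\operatorname{supp}u=\overline{[u]^{\ast}}$. $\mathcal{F}_X^{\ast\ast}$ is the set of $u:X\to[0,1]$ that are normal ($u(x)=1$ for some $x\in X$) and compactly supported ($\operatorname{supp}u$ is compact); $\mathcal{F}_X^{\ast}$ is the set of upper semicontinuous elements of $\mathcal{F}_X^{\ast\ast}$. $\mathcal{F}_{\mathcal{S}}^{\ast}$ is the set of $u\in\mathcal{F}_X^{\ast}$ such that for each $x\in[u]^{\ast}$ there exist $w_x,y_x\in X$ with $x,y_x\in\mathcal{O}(w_x)$ and $u(y_x)=1$. On $\mathcal{F}_X^{\ast}$ one uses the metric $d_\infty(u,v)=\sup_{\alpha\in[0,1]}h([u]^\alpha,[v]^\alpha)$, where $h(A,B)=\max\{\sup_{a\in A}d(a,B),\sup_{b\in B}d(b,A)\}$ is the Hausdorff-Pompeiu distance. For $f:X\to X$ and $u:X\to[0,1]$, $f(u):X\to[0,1]$ is given by $f(u)(y)=\sup_{x\in f^{-1}(\{y\})}u(x)$ if $f^{-1}(\{y\})\neq\emptyset$ and $f(u)(y)=0$ otherwise. The fuzzy Hutchinson-Barnsley operator is $Z(u)=\bigvee_{i\in I}\rho_i\circ(f_i(u))$ (pointwise supremum); it maps $\mathcal{F}_X^{\ast}$ into itself, and $Z^{[n]}$ denotes its $n$-fold iterate. For $u\in\mathcal{F}_{\mathcal{S}}^{\ast}$, $\mathbf{u}_u=\lim_{n\to\infty}Z^{[n]}(u)$ (limit in $(\mathcal{F}_X^{\ast},d_\infty)$, which exists). For $u\in\mathcal{F}_{\mathcal{S}}^{\ast}$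 and $x\in[u]^{\ast}$, with $w_x,y_x$ as in the definition of $\mathcal{F}_{\mathcal{S}}^{\ast}$, let $u^x:X\to[0,1]$ be given by $u^x(y)=u(y)$ if $y\in\overline{\mathcal{O}(w_x)}$ and $u^x(y)=0$ otherwise, and $\mathbf{u}_x=\lim_{n\to\infty}Z^{[n]}(u^x)$ (limit in $(\mathcal{F}_X^{\ast},d_\infty)$, which exists and does not depend on the choice of $w_x,y_x$). *)

theory Defs
  imports "HOL-Analysis.Analysis"
begin

text \<open>
  The index family is a finite set \<open>I\<close>; functions with values in or defined on \<open>[0,1]\<close> are
  real-valued functions with explicit range and domain restrictions.
\<close>

section \<open>Orbital fuzzy iterated function systems\<close>

text \<open>A word \<open>[i\<^sub>1, \<dots>, i\<^sub>n]\<close> acts by \<open>foldr f [i\<^sub>1, \<dots>, i\<^sub>n] x = f i\<^sub>1 (\<dots> (f i\<^sub>n x))\<close>.\<close>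

definition orbit :: "'i set \<Rightarrow> ('i \<Rightarrow> 'a \<Rightarrow> 'a) \<Rightarrow> 'a \<Rightarrow> 'a set" where
  "orbit I f x = {x} \<union> {foldr f \<omega> x | \<omega>. \<omega> \<noteq> [] \<and> set \<omega> \<subseteq> I}"

locale orbital_fuzzy_ifs =
  fixes I :: "'i set"
    and f :: "'i \<Rightarrow> 'a::complete_space \<Rightarrow> 'a"
    and \<rho> :: "'i \<Rightarrow> real \<Rightarrow> real"
  assumes finite_index: "finite I"
    and continuous_maps: "\<And>i. i \<in> I \<Longrightarrow> continuous_on UNIV (f i)"
    and orbital_contraction:
      "\<exists>C. 0 \<le> C \<and> C < 1 \<and>
        (\<forall>i\<in>I. \<forall>x. \<forall>y\<in>orbit I f x. \<forall>z\<in>orbit I f x. dist (f i y) (f i z) \<le> C * dist y z)"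
    and rho_range: "\<And>i. i \<in> I \<Longrightarrow> \<rho> i \<in> {0..1} \<rightarrow> {0..1}"
    and rho_nonzero: "\<And>i. i \<in> I \<Longrightarrow> \<exists>t\<in>{0..1}. \<rho> i t \<noteq> 0"
    and rho_mono: "\<And>i. i \<in> I \<Longrightarrow> mono_on {0..1} (\<rho> i)"
    \<comment> \<open>The values of \<open>\<rho> i\<close> beyond 1 carry no meaning, so nothing is required at 1.\<close>
    and rho_right_continuous: "\<And>i t. i \<in> I \<Longrightarrow> t \<in> {0..<1} \<Longrightarrow> continuous (at_right t) (\<rho> i)"
    and rho_zero: "\<And>i. i \<in> I \<Longrightarrow> \<rho> i 0 = 0"
    and rho_one: "\<exists>j\<in>I. \<rho> j 1 = 1"


section \<open>Fuzzy sets\<close>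

definition positive_set :: "('a \<Rightarrow> real) \<Rightarrow> 'a set" where
  "positive_set u = {x. u x > 0}"

definition level_set :: "('a::topological_space \<Rightarrow> real) \<Rightarrow> real \<Rightarrow> 'a set" where
  "level_set u \<alpha> = (if \<alpha> = 0 then closure (positive_set u) else {x. u x \<ge> \<alpha>})"

definition upper_semicontinuous :: "('a::topological_space \<Rightarrow> real) \<Rightarrow> bool" where
  "upper_semicontinuous u \<longleftrightarrow> (\<forall>x. \<forall>a>u x. \<forall>\<^sub>F y in nhds x. u y < a)"

definition fuzzy_compact :: "('a::topological_space \<Rightarrow> real) set" where
  "fuzzy_compact =
    {u. range u \<subseteq> {0..1} \<and> (\<exists>x. u x = 1) \<and> compact (level_set u 0)}"

definition fuzzy_compact_usc :: "('a::topological_space \<Rightarrow> real) set" where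
  "fuzzy_compact_usc = {u \<in> fuzzy_compact. upper_semicontinuous u}"

definition fuzzy_orbital ::
    "'i set \<Rightarrow> ('i \<Rightarrow> 'a::topological_space \<Rightarrow> 'a) \<Rightarrow> ('a \<Rightarrow> real) set" where
  "fuzzy_orbital I f =
    {u \<in> fuzzy_compact_usc.
      \<forall>x\<in>positive_set u. \<exists>w y. x \<in> orbit I f w \<and> y \<in> orbit I f w \<and> u y = 1}"


section \<open>The metric on fuzzy sets\<close>

text \<open>
  The suprema below are real-valued. They are genuine suprema in the case of use: the level
  sets of elements of \<open>fuzzy_compact_usc\<close> are nonempty and compact, and they all lie in the
  compact support.
\<close>

definition hausdorff_dist :: "'a::metric_space set \<Rightarrow> 'a set \<Rightarrow> real" where
  "hausdorff_dist A B = max (SUP a\<in>A. infdist a B) (SUP b\<in>B. infdist b A)"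

definition fuzzy_dist :: "('a::metric_space \<Rightarrow> real) \<Rightarrow> ('a \<Rightarrow> real) \<Rightarrow> real" where
  "fuzzy_dist u v = (SUP \<alpha>\<in>{0..1}. hausdorff_dist (level_set u \<alpha>) (level_set v \<alpha>))"

definition fuzzy_lim :: "(nat \<Rightarrow> 'a::metric_space \<Rightarrow> real) \<Rightarrow> 'a \<Rightarrow> real" where
  "fuzzy_lim s = (THE v. v \<in> fuzzy_compact_usc \<and> (\<lambda>n. fuzzy_dist (s n) v) \<longlonglongrightarrow> 0)"


section \<open>The fuzzy Hutchinson--Barnsley operator\<close>

definition fuzzy_image :: "('a \<Rightarrow> 'a) \<Rightarrow> ('a \<Rightarrow> real) \<Rightarrow> 'a \<Rightarrow> real" where
  "fuzzy_image g u y = (if g -` {y} \<noteq> {} then (SUP x\<in>g -` {y}. u x) else 0)"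

definition hutchinson ::
    "'i set \<Rightarrow> ('i \<Rightarrow> 'a \<Rightarrow> 'a) \<Rightarrow> ('i \<Rightarrow> real \<Rightarrow> real) \<Rightarrow> ('a \<Rightarrow> real) \<Rightarrow> 'a \<Rightarrow> real" where
  "hutchinson I f \<rho> u y = (SUP i\<in>I. \<rho> i (fuzzy_image (f i) u y))"

definition hutchinson_lim ::
    "'i set \<Rightarrow> ('i \<Rightarrow> 'a::metric_space \<Rightarrow> 'a) \<Rightarrow> ('i \<Rightarrow> real \<Rightarrow> real) \<Rightarrow> ('a \<Rightarrow> real) \<Rightarrow> 'a \<Rightarrow> real"
  where
  "hutchinson_lim I f \<rho> u = fuzzy_lim (\<lambda>n. (hutchinson I f \<rho> ^^ n) u)"

definition orbit_restrict ::
    "'i set \<Rightarrow> ('i \<Rightarrow> 'a::topological_space \<Rightarrow> 'a) \<Rightarrow> ('a \<Rightarrow> real) \<Rightarrow> 'a \<Rightarrow> 'a \<Rightarrow> real" where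
  "orbit_restrict I f u w y = (if y \<in> closure (orbit I f w) then u y else 0)"

end

theory Submission
  imports Defs
begin

text \<open>
  Put \<open>A = {x. u x = 1}\<close> and, for a word \<open>\<sigma> = [i\<^sub>1, \<dots>, i\<^sub>n]\<close>, write \<open>f\<^sub>\<sigma>\<close> and \<open>\<rho>\<^sub>\<sigma>\<close> for the
  compositions \<open>foldr f \<sigma>\<close> and \<open>foldr \<rho> \<sigma>\<close>. Because suprema over fibers of fuzzy sets with compact
  levels are attained and each \<open>\<rho>\<^sub>i\<close> is right continuous, the value of the \<open>n\<close>-th iterate of
  \<open>u\<close> at \<open>z\<close>, when
  positive, is the largest \<open>\<rho>\<^sub>\<sigma> (u x)\<close> over words \<open>\<sigma>\<close> of length \<open>n\<close> and points \<open>x\<close> with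
  \<open>f\<^sub>\<sigma> x = z\<close> (lemmas \<open>iterate_lower\<close> and \<open>iterate_attained\<close>).

  Let \<open>C\<close> be the contraction constant, called \<open>ratio\<close> below.
  A point \<open>x\<close> of positive value shares an orbit with some \<open>y\<close> in \<open>A\<close>. The word \<open>\<sigma>\<close> moves \<open>y\<close> to
  within \<open>C\<^sup>n dist x y\<close> of \<open>f\<^sub>\<sigma> x\<close>, and \<open>\<rho>\<^sub>\<sigma> (u x) \<le> \<rho>\<^sub>\<sigma> 1\<close>. So in the limit only the points of \<open>A\<close>,
  all of weight 1, matter: they are the seeds of the limit. The level \<open>\<alpha>\<close> of the limit should consist
  of the points \<open>z\<close> for which some seed \<open>a\<close> has, for every \<open>n\<close>, a word \<open>\<sigma>\<close> of length \<open>n\<close> with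
  \<open>\<rho>\<^sub>\<sigma> 1 \<ge> \<alpha>\<close> and \<open>dist z (f\<^sub>\<sigma> a) \<le> K C\<^sup>n\<close>, where \<open>K\<close> is a constant with
  \<open>dist (f\<^sub>i a) a \<le> K (1 - C)\<close> for all seeds. This is the definition of \<open>attractor_level\<close>, and
  \<open>hutchinson_lim_eq_attractor\<close> shows that the fuzzy set with these levels is the limit.

  The seed \<open>a\<close> in that definition is chosen before \<open>n\<close>. Hence the attractor of \<open>A\<close> is at every point
  the maximum over \<open>a\<close> in \<open>A\<close> of the attractors of the single seeds \<open>a\<close>. The fuzzy set \<open>u\<close>
  restricted to the closed orbit of \<open>w x\<close> has as its seeds those points of \<open>A\<close> that lie in this closed
  orbit. They form a subset of \<open>A\<close>, so its attractor is below that of \<open>A\<close>; and for \<open>x\<close> in \<open>A\<close> they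
  include \<open>x\<close> itself. So every value of the attractor of \<open>A\<close> is reached by some \<open>x\<close> in \<open>A\<close>, and all
  the suprema in question are maxima with that value.
\<close>

section \<open>Compactness and distances\<close>

lemma compact_nested_nonempty:
  fixes F :: "nat \<Rightarrow> 'b::t2_space set"
  assumes compact: "\<And>n. compact (F n)" and nonempty: "\<And>n. F n \<noteq> {}"
    and decreasing: "\<And>n. F (Suc n) \<subseteq> F n"
  shows "\<exists>x. \<forall>n. x \<in> F n"
proof -
  have mono: "F n \<subseteq> F m" if "m \<le> n" for m n
    using lift_Suc_antimono_le[of F, OF decreasing that] .
  have "F 0 \<inter> (\<Inter>n\<in>UNIV. F n) \<noteq> {}"
  proof (rule compact_imp_fip_image)
    show "compact (F 0)" by (rule compact)
    show "closed (F n)" for n by (rule compact_imp_closed[OF compact])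
    fix J :: "nat set"
    assume J: "finite J"
    have "F (Max (insert 0 J)) \<subseteq> F 0 \<inter> (\<Inter>n\<in>J. F n)"
      using J mono[of _ "Max (insert 0 J)"] by (simp add: le_INF_iff)
    then show "F 0 \<inter> (\<Inter>n\<in>J. F n) \<noteq> {}"
      using nonempty by blast
  qed
  then show ?thesis by blast
qed

lemma infdist_less_witness:
  assumes "infdist x A < e" "A \<noteq> {}"
  obtains a where "a \<in> A" "dist x a < e"
proof -
  have "(INF a\<in>A. dist x a) < e" "dist x ` A \<noteq> {}"
    using assms by (auto simp: infdist_def)
  then obtain t where "t \<in> dist x ` A" "t < e"
    using cInf_lessD by metis
  then show thesis using that by auto
qed

text \<open>
  The common bound \<open>e\<close> on the infimal distances makes the two real suprema genuine; this is what
  yields the lower bound 0.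
\<close>

lemma hausdorff_dist_bounds:
  assumes "A \<noteq> {}" "B \<noteq> {}"
    and "\<And>a. a \<in> A \<Longrightarrow> infdist a B \<le> e" "\<And>b. b \<in> B \<Longrightarrow> infdist b A \<le> e"
  shows "hausdorff_dist A B \<in> {0..e}"
proof -
  obtain a where a: "a \<in> A" using assms by blast
  have "bdd_above ((\<lambda>a. infdist a B) ` A)"
    using assms(3) by (auto simp: bdd_above_def)
  then have "infdist a B \<le> (SUP a\<in>A. infdist a B)"
    using a by (intro cSUP_upper)
  then have "0 \<le> (SUP a\<in>A. infdist a B)"
    using infdist_nonneg[of a B] by linarith
  moreover have "(SUP a\<in>A. infdist a B) \<le> e" "(SUP b\<in>B. infdist b A) \<le> e"
    using assms by (auto intro!: cSUP_least)
  ultimately show ?thesis by (auto simp: hausdorff_dist_def)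
qed

text \<open>
  Boundedness enters because a real supremum over an unbounded set says nothing about the
  members of that set.
\<close>

lemma infdist_le_hausdorff_dist:
  assumes "bounded A" "bounded B" "A \<noteq> {}" "B \<noteq> {}"
  shows "a \<in> A \<Longrightarrow> infdist a B \<le> hausdorff_dist A B"
    and "b \<in> B \<Longrightarrow> infdist b A \<le> hausdorff_dist A B"
proof -
  have bdd: "bdd_above ((\<lambda>x. infdist x T) ` S)" if S: "bounded S" and T: "T \<noteq> {}" for S T :: "'a set"
  proof -
    obtain t where t: "t \<in> T" using T by blast
    obtain e where e: "\<And>y. y \<in> S \<Longrightarrow> dist t y \<le> e"
      using S bounded_any_center by metis
    have "infdist x T \<le> e" if "x \<in> S" for x
      using e[OF that] by (intro infdist_le2[OF t]) (simp add: dist_commute)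
    then show ?thesis by (auto simp: bdd_above_def)
  qed
  show "a \<in> A \<Longrightarrow> infdist a B \<le> hausdorff_dist A B"
    unfolding hausdorff_dist_def
    by (intro max.coboundedI1 cSUP_upper bdd assms)
  show "b \<in> B \<Longrightarrow> infdist b A \<le> hausdorff_dist A B"
    unfolding hausdorff_dist_def
    by (intro max.coboundedI2 cSUP_upper bdd assms)
qed

section \<open>Fuzzy sets\<close>

lemma upper_semicontinuous_iff_closed:
  fixes u :: "'a::topological_space \<Rightarrow> real"
  shows "upper_semicontinuous u \<longleftrightarrow> (\<forall>\<alpha>. closed {x. u x \<ge> \<alpha>})"
proof
  assume usc: "upper_semicontinuous u"
  show "\<forall>\<alpha>. closed {x. u x \<ge> \<alpha>}"
  proof
    fix \<alpha>
    have "open {x. u x < \<alpha>}"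
    proof (subst open_subopen, safe)
      fix x assume "u x < \<alpha>"
      with usc have "\<forall>\<^sub>F y in nhds x. u y < \<alpha>"
        by (auto simp: upper_semicontinuous_def)
      then show "\<exists>T. open T \<and> x \<in> T \<and> T \<subseteq> {x. u x < \<alpha>}"
        unfolding eventually_nhds by blast
    qed
    then show "closed {x. u x \<ge> \<alpha>}"
      by (simp add: closed_def Collect_neg_eq[symmetric] not_le)
  qed
next
  assume cl: "\<forall>\<alpha>. closed {x. u x \<ge> \<alpha>}"
  have "open {x. u x < \<alpha>}" for \<alpha>
    using cl[rule_format, of \<alpha>] by (simp add: closed_def Collect_neg_eq[symmetric] not_le)
  then show "upper_semicontinuous u"
    unfolding upper_semicontinuous_def eventually_nhds by blast
qed

text \<open>
  The part of compact support and upper semicontinuity that makes suprema over fibers attained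
  and that a single application of the fuzzy operator visibly preserves.
\<close>

definition levels_compact :: "('a::topological_space \<Rightarrow> real) \<Rightarrow> bool" where
  "levels_compact u \<longleftrightarrow> range u \<subseteq> {0..1} \<and> (\<forall>\<alpha>>0. compact {x. u x \<ge> \<alpha>})"

lemma unit_range: "range u \<subseteq> {0..1::real} \<Longrightarrow> 0 \<le> u x \<and> u x \<le> 1"
  by (auto simp: image_subset_iff)

lemma levels_compact_range: "levels_compact u \<Longrightarrow> u x \<in> {0..1}"
  by (simp add: levels_compact_def unit_range)

lemma fuzzy_compact_usc_range:
  assumes "u \<in> fuzzy_compact_usc"
  shows "0 \<le> u x" "u x \<le> 1"
  using assms unfolding fuzzy_compact_usc_def fuzzy_compact_def image_subset_iff by auto

lemma fuzzy_compact_usc_support: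
  assumes "u \<in> fuzzy_compact_usc"
  shows "compact (closure (positive_set u))"
  using assms unfolding fuzzy_compact_usc_def fuzzy_compact_def level_set_def by auto

lemma fuzzy_compact_usc_levels_compact:
  assumes "u \<in> fuzzy_compact_usc"
  shows "levels_compact u"
  unfolding levels_compact_def
proof (intro conjI allI impI)
  show "range u \<subseteq> {0..1}"
    using assms by (simp add: fuzzy_compact_usc_def fuzzy_compact_def)
  fix \<alpha> :: real assume "\<alpha> > 0"
  then have "{x. u x \<ge> \<alpha>} = closure (positive_set u) \<inter> {x. u x \<ge> \<alpha>}"
    using closure_subset[of "positive_set u"] by (auto simp: positive_set_def)
  moreover have "closed {x. u x \<ge> \<alpha>}"
    using assms by (simp add: fuzzy_compact_usc_def upper_semicontinuous_iff_closed)
  ultimately show "compact {x. u x \<ge> \<alpha>}"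
    using compact_Int_closed[OF fuzzy_compact_usc_support[OF assms]] by metis
qed

text \<open>
  Each superlevel set of \<open>u\<close> at a positive height lies in the closed \<open>e\<close>-neighbourhood of the
  corresponding set of \<open>v\<close>, expressed pointwise.
\<close>

definition levels_within :: "('a::metric_space \<Rightarrow> real) \<Rightarrow> ('a \<Rightarrow> real) \<Rightarrow> real \<Rightarrow> bool" where
  "levels_within u v e \<longleftrightarrow> (\<forall>z. u z > 0 \<longrightarrow> (\<exists>z'. v z' \<ge> u z \<and> dist z z' \<le> e))"

text \<open>
  At height 0 the level set is a closure, so the estimate for the positive sets passes to it by
  approximation.
\<close>

lemma level_set_infdist_le:
  fixes u v :: "'a::metric_space \<Rightarrow> real"
  assumes "levels_within u v e" "0 \<le> \<alpha>" "z \<in> level_set u \<alpha>"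
  shows "infdist z (level_set v \<alpha>) \<le> e"
proof (cases "\<alpha> = 0")
  case False
  then have "u z \<ge> \<alpha>" "\<alpha> > 0" using assms by (auto simp: level_set_def)
  then obtain z' where "v z' \<ge> u z" "dist z z' \<le> e"
    using assms(1) unfolding levels_within_def by (meson less_le_trans)
  then show ?thesis
    using \<open>u z \<ge> \<alpha>\<close> False by (intro infdist_le2[of z']) (auto simp: level_set_def)
next
  case True
  show ?thesis
  proof (rule field_le_epsilon)
    fix d :: real assume "d > 0"
    then obtain y where y: "u y > 0" "dist z y < d"
      using assms(3) True
      by (auto simp: level_set_def closure_approachable positive_set_def dist_commute)
    obtain z' where z': "v z' \<ge> u y" "dist y z' \<le> e"
      using assms(1) y unfolding levels_within_def by blast
    have "z' \<in> closure (positive_set v)"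
      using y z' closure_subset[of "positive_set v"] by (auto simp: positive_set_def)
    moreover have "dist z z' \<le> e + d"
      using dist_triangle[of z z' y] y z' by linarith
    ultimately show "infdist z (level_set v \<alpha>) \<le> e + d"
      using True by (intro infdist_le2[of z']) (auto simp: level_set_def)
  qed
qed

lemma level_set_nonempty:
  assumes "u x = 1" "\<alpha> \<in> {0..1}"
  shows "level_set u \<alpha> \<noteq> {}"
proof -
  have "x \<in> level_set u \<alpha>"
    using assms closure_subset[of "positive_set u"] by (auto simp: level_set_def positive_set_def)
  then show ?thesis by blast
qed

lemma levels_within_hausdorff_dist:
  fixes u v :: "'a::metric_space \<Rightarrow> real"
  assumes "u x = 1" "v y = 1" "levels_within u v e" "levels_within v u e" "\<alpha> \<in> {0..1}"
  shows "hausdorff_dist (level_set u \<alpha>) (level_set v \<alpha>) \<in> {0..e}"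
  using assms by (intro hausdorff_dist_bounds level_set_nonempty level_set_infdist_le) auto

lemma levels_within_fuzzy_dist:
  fixes u v :: "'a::metric_space \<Rightarrow> real"
  assumes "u x = 1" "v y = 1" "levels_within u v e" "levels_within v u e"
  shows "fuzzy_dist u v \<in> {0..e}"
proof -
  let ?h = "\<lambda>\<alpha>. hausdorff_dist (level_set u \<alpha>) (level_set v \<alpha>)"
  have h: "?h \<alpha> \<in> {0..e}" if "\<alpha> \<in> {0..1}" for \<alpha>
    using levels_within_hausdorff_dist[OF assms that] .
  have "?h 0 \<le> fuzzy_dist u v"
    unfolding fuzzy_dist_def using h by (intro cSUP_upper bdd_aboveI2[where M = e]) auto
  moreover have "fuzzy_dist u v \<le> e"
    unfolding fuzzy_dist_def using h by (intro cSUP_least) auto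
  ultimately show ?thesis using h[of 0] by auto
qed

lemma level_set_subset_support:
  assumes "0 \<le> \<alpha>"
  shows "level_set u \<alpha> \<subseteq> closure (positive_set u)"
  using assms closure_subset[of "positive_set u"] by (auto simp: level_set_def positive_set_def)

lemma hausdorff_dist_le_fuzzy_dist:
  fixes u v :: "'a::metric_space \<Rightarrow> real"
  assumes "u x = 1" "v y = 1" "bounded (positive_set u)" "bounded (positive_set v)"
    and "\<alpha> \<in> {0..1}"
  shows "hausdorff_dist (level_set u \<alpha>) (level_set v \<alpha>) \<le> fuzzy_dist u v"
  unfolding fuzzy_dist_def
proof (rule cSUP_upper)
  show "\<alpha> \<in> {0..1}" by fact
  let ?S = "closure (positive_set u) \<union> closure (positive_set v)"
  have "bounded ?S" using assms(3,4) by (simp add: bounded_closure)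
  then obtain e where e: "\<And>a b. a \<in> ?S \<Longrightarrow> b \<in> ?S \<Longrightarrow> dist a b \<le> e"
    using bounded_two_points[of ?S] by blast
  have "hausdorff_dist (level_set u \<beta>) (level_set v \<beta>) \<in> {0..e}" if \<beta>: "\<beta> \<in> {0..1}" for \<beta>
  proof (rule hausdorff_dist_bounds)
    show ne: "level_set u \<beta> \<noteq> {}" "level_set v \<beta> \<noteq> {}"
      using level_set_nonempty[of u x \<beta>] level_set_nonempty[of v y \<beta>] assms(1,2) \<beta> by blast+
    have sub: "level_set u \<beta> \<subseteq> ?S" "level_set v \<beta> \<subseteq> ?S"
      using level_set_subset_support[of \<beta> u] level_set_subset_support[of \<beta> v] \<beta> by auto
    show "infdist a (level_set v \<beta>) \<le> e" if "a \<in> level_set u \<beta>" for a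
      using ne sub that e by (metis all_not_in_conv infdist_le2 subsetD)
    show "infdist a (level_set u \<beta>) \<le> e" if "a \<in> level_set v \<beta>" for a
      using ne sub that e by (metis all_not_in_conv infdist_le2 subsetD)
  qed
  then show "bdd_above ((\<lambda>\<beta>. hausdorff_dist (level_set u \<beta>) (level_set v \<beta>)) ` {0..1})"
    by (intro bdd_aboveI2[where M = e]) auto
qed

lemma levels_within_bounded:
  fixes u v :: "'a::metric_space \<Rightarrow> real"
  assumes "levels_within u v e" "bounded (positive_set v)"
  shows "bounded (positive_set u)"
proof -
  obtain c r where r: "\<And>y. v y > 0 \<Longrightarrow> dist c y \<le> r"
    using assms(2) unfolding bounded_def positive_set_def by auto
  have "dist c z \<le> r + e" if z: "u z > 0" for z
  proof -
    obtain z' where "v z' \<ge> u z" "dist z z' \<le> e"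
      using assms(1) z unfolding levels_within_def by blast
    then show ?thesis
      using r[of z'] z dist_triangle[of c z z'] dist_commute[of z z'] by linarith
  qed
  then show ?thesis unfolding bounded_def positive_set_def by blast
qed

text \<open>
  One half of the uniqueness of limits: a point in a level of \<open>v\<close> has points of the same level
  of the iterates arbitrarily near it, and these are near the level of \<open>v'\<close>, which is closed.
\<close>

lemma fuzzy_limit_le:
  fixes v v' :: "'a::metric_space \<Rightarrow> real"
  assumes v: "v \<in> fuzzy_compact_usc" and v': "v' \<in> fuzzy_compact_usc"
    and normal: "\<And>n. \<exists>x. s n x = 1" and bounded: "\<And>n. bounded (positive_set (s n))"
    and lim: "(\<lambda>n. fuzzy_dist (s n) v) \<longlonglongrightarrow> 0" "(\<lambda>n. fuzzy_dist (s n) v') \<longlonglongrightarrow> 0"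
  shows "v z \<le> v' z"
proof (cases "v z > 0")
  case False
  then show ?thesis using fuzzy_compact_usc_range(1)[OF v', of z] by linarith
next
  case True
  let ?a = "v z"
  have a: "?a \<in> {0..1}" using fuzzy_compact_usc_range[OF v] by simp
  obtain x where x: "v x = 1" using v by (auto simp: fuzzy_compact_usc_def fuzzy_compact_def)
  obtain y where y: "v' y = 1" using v' by (auto simp: fuzzy_compact_usc_def fuzzy_compact_def)
  have bd: "bounded (closure (positive_set v))" "bounded (closure (positive_set v'))"
    using v v' compact_imp_bounded fuzzy_compact_usc_support by blast+
  then have bp: "bounded (positive_set v)" "bounded (positive_set v')"
    using bounded_subset closure_subset by blast+
  have bl: "bounded (level_set w ?a)" if "bounded (positive_set w)" for w :: "'a \<Rightarrow> real"
    using that bounded_subset[OF bounded_closure level_set_subset_support] a by auto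
  have "infdist z (level_set v' ?a) \<le> fuzzy_dist (s n) v + fuzzy_dist (s n) v'" for n
  proof (rule field_le_epsilon)
    fix d :: real assume d: "d > 0"
    obtain t where t: "s n t = 1" using normal by blast
    have ne: "level_set v ?a \<noteq> {}" "level_set v' ?a \<noteq> {}" "level_set (s n) ?a \<noteq> {}"
      using level_set_nonempty x y t a by metis+
    have "infdist z (level_set (s n) ?a) \<le> hausdorff_dist (level_set (s n) ?a) (level_set v ?a)"
      using True by (intro infdist_le_hausdorff_dist bl bounded bp ne) (simp add: level_set_def)
    also have "\<dots> \<le> fuzzy_dist (s n) v"
      by (rule hausdorff_dist_le_fuzzy_dist[OF t x bounded bp(1) a])
    finally have "infdist z (level_set (s n) ?a) < fuzzy_dist (s n) v + d"
      using d by linarith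
    then obtain b where b: "b \<in> level_set (s n) ?a" "dist z b < fuzzy_dist (s n) v + d"
      using infdist_less_witness ne by metis
    have "infdist b (level_set v' ?a) \<le> hausdorff_dist (level_set (s n) ?a) (level_set v' ?a)"
      by (intro infdist_le_hausdorff_dist bl bounded bp ne b)
    also have "\<dots> \<le> fuzzy_dist (s n) v'"
      by (rule hausdorff_dist_le_fuzzy_dist[OF t y bounded bp(2) a])
    finally show "infdist z (level_set v' ?a) \<le> fuzzy_dist (s n) v + fuzzy_dist (s n) v' + d"
      using b infdist_triangle[of z "level_set v' ?a" b] by linarith
  qed
  then have "infdist z (level_set v' ?a) \<le> 0 + 0"
    by (intro LIMSEQ_le_const[OF tendsto_add[OF lim]]) auto
  then have "infdist z (level_set v' ?a) = 0"
    using infdist_nonneg[of z "level_set v' ?a"] by linarith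
  moreover have "closed (level_set v' ?a)"
    using v' True by (simp add: level_set_def fuzzy_compact_usc_def upper_semicontinuous_iff_closed)
  moreover have "level_set v' ?a \<noteq> {}"
    using level_set_nonempty y a by metis
  ultimately have "z \<in> level_set v' ?a"
    using in_closed_iff_infdist_zero by blast
  then show ?thesis using True by (simp add: level_set_def)
qed

text \<open>
  The limit is defined as the unique limit point, so computing it means exhibiting a
  candidate, estimating the levels, and knowing that limits are unique.
\<close>

lemma fuzzy_lim_eqI:
  fixes v :: "'a::metric_space \<Rightarrow> real"
  assumes v: "v \<in> fuzzy_compact_usc"
    and normal: "\<And>n. \<exists>x. s n x = 1"
    and within: "\<And>n. levels_within (s n) v (e n)" "\<And>n. levels_within v (s n) (e n)"
    and e: "e \<longlonglongrightarrow> 0"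
  shows "fuzzy_lim s = v"
  unfolding fuzzy_lim_def
proof (rule the_equality)
  have "fuzzy_dist (s n) v \<in> {0..e n}" for n
  proof -
    obtain x y where "s n x = 1" "v y = 1"
      using normal[of n] v by (auto simp: fuzzy_compact_usc_def fuzzy_compact_def)
    then show ?thesis by (rule levels_within_fuzzy_dist[OF _ _ within])
  qed
  then have lim: "(\<lambda>n. fuzzy_dist (s n) v) \<longlonglongrightarrow> 0"
    by (intro tendsto_sandwich[OF _ _ tendsto_const e]) auto
  then show "v \<in> fuzzy_compact_usc \<and> (\<lambda>n. fuzzy_dist (s n) v) \<longlonglongrightarrow> 0"
    using v by blast
  have "bounded (closure (positive_set v))"
    by (rule compact_imp_bounded[OF fuzzy_compact_usc_support[OF v]])
  then have "bounded (positive_set v)"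
    using bounded_subset closure_subset by blast
  then have bounded: "bounded (positive_set (s n))" for n
    using levels_within_bounded within by blast
  fix v'
  assume "v' \<in> fuzzy_compact_usc \<and> (\<lambda>n. fuzzy_dist (s n) v') \<longlonglongrightarrow> 0"
  then have v': "v' \<in> fuzzy_compact_usc" "(\<lambda>n. fuzzy_dist (s n) v') \<longlonglongrightarrow> 0" by auto
  show "v' = v"
  proof (intro ext antisym)
    fix z
    show "v' z \<le> v z" by (rule fuzzy_limit_le[OF v'(1) v normal bounded v'(2) lim])
    show "v z \<le> v' z" by (rule fuzzy_limit_le[OF v v'(1) normal bounded lim v'(2)])
  qed
qed

lemma fuzzy_image_upper:
  assumes "range u \<subseteq> {0..1}"
  shows "u x \<le> fuzzy_image g u (g x)"
proof -
  have "bdd_above (u ` (g -` {g x}))"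
    using unit_range[OF assms] by (intro bdd_aboveI2[where M = 1]) auto
  then have "u x \<le> (SUP x\<in>g -` {g x}. u x)"
    by (intro cSUP_upper) auto
  then show ?thesis by (auto simp: fuzzy_image_def)
qed

lemma fuzzy_image_range:
  assumes "range u \<subseteq> {0..1}"
  shows "fuzzy_image g u y \<in> {0..1}"
proof (cases "g -` {y} = {}")
  case False
  then obtain x where "g x = y" by auto
  then have "0 \<le> fuzzy_image g u y"
    using fuzzy_image_upper[OF assms, of x g] unit_range[OF assms, of x] order_trans[of 0 "u x"] by auto
  moreover have "fuzzy_image g u y \<le> 1"
    using False unit_range[OF assms] by (auto simp: fuzzy_image_def intro!: cSUP_least)
  ultimately show ?thesis by simp
qed (simp add: fuzzy_image_def)

text \<open>
  The superlevel sets of \<open>u\<close> in a fiber of \<open>g\<close>, at heights increasing to the supremum, are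
  nested nonempty compact sets; a common point attains the supremum.
\<close>

lemma fuzzy_image_attained:
  fixes u :: "'a::t2_space \<Rightarrow> real"
  assumes u: "levels_compact u" and g: "continuous_on UNIV g" and pos: "fuzzy_image g u y > 0"
  shows "\<exists>x. g x = y \<and> u x = fuzzy_image g u y"
proof -
  let ?V = "g -` {y}"
  define s where "s = fuzzy_image g u y"
  have V: "?V \<noteq> {}" and s: "s = (SUP x\<in>?V. u x)"
    using pos by (auto simp: fuzzy_image_def s_def split: if_splits)
  have spos: "s > 0" using pos s_def by simp
  \<comment> \<open>heights increasing strictly to the supremum, all positive\<close>
  define t where "t = (\<lambda>n::nat. s - s / 2 * inverse (real (Suc n)))"
  have t: "0 < t n" "t n < s" "t n \<le> t (Suc n)" for n
  proof -
    have "inverse (real (Suc n)) \<le> 1" "0 < inverse (real (Suc n))"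
      "inverse (real (Suc (Suc n))) \<le> inverse (real (Suc n))"
      by (auto simp: field_simps)
    then have "s / 2 * inverse (real (Suc n)) \<le> s / 2 * 1" "0 < s / 2 * inverse (real (Suc n))"
      "s / 2 * inverse (real (Suc (Suc n))) \<le> s / 2 * inverse (real (Suc n))"
      using spos by (intro mult_left_mono mult_pos_pos; simp)+
    then show "0 < t n" "t n < s" "t n \<le> t (Suc n)"
      using spos by (simp_all add: t_def del: of_nat_Suc)
  qed
  have "\<exists>x. \<forall>n. x \<in> ?V \<inter> {x. u x \<ge> t n}"
  proof (rule compact_nested_nonempty)
    fix n
    show "compact (?V \<inter> {x. u x \<ge> t n})"
      using u t(1) g
      by (intro closed_Int_compact closed_vimage) (auto simp: levels_compact_def)
    obtain a where "a \<in> u ` ?V" "t n < a"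
      using less_cSupE[of "t n" "u ` ?V"] t(2)[of n] s V by auto
    then show "?V \<inter> {x. u x \<ge> t n} \<noteq> {}" by force
    show "?V \<inter> {x. u x \<ge> t (Suc n)} \<subseteq> ?V \<inter> {x. u x \<ge> t n}"
      using t(3)[of n] by auto
  qed
  then obtain x where x: "g x = y" "\<And>n. t n \<le> u x" by auto
  have "t \<longlonglongrightarrow> s - s / 2 * 0"
    unfolding t_def by (intro tendsto_intros LIMSEQ_inverse_real_of_nat)
  then have "s \<le> u x"
    using x(2) by (intro LIMSEQ_le_const2[of t]) auto
  moreover have "u x \<le> s"
    using fuzzy_image_upper[of u x g] u x by (simp add: levels_compact_def s_def)
  ultimately show ?thesis using x s_def by auto
qed

section \<open>Iterates of the fuzzy operator\<close>

context orbital_fuzzy_ifs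
begin

lemma rho_in: "i \<in> I \<Longrightarrow> t \<in> {0..1} \<Longrightarrow> \<rho> i t \<in> {0..1}"
  using rho_range by blast

lemma rho_le: "i \<in> I \<Longrightarrow> 0 \<le> s \<Longrightarrow> s \<le> t \<Longrightarrow> t \<le> 1 \<Longrightarrow> \<rho> i s \<le> \<rho> i t"
  using rho_mono[of i] by (auto intro: mono_onD)

lemma index_nonempty: "I \<noteq> {}"
  using rho_one by blast

text \<open>
  Right continuity makes the infimum of the superlevel set of a nondecreasing function a member
  of it, and \<open>\<rho> i 0 = 0\<close> keeps it away from 0. Composition with \<open>\<rho> i\<close> therefore only relabels levels.
\<close>

lemma rho_superlevel:
  assumes i: "i \<in> I" and \<alpha>: "\<alpha> > 0" and T: "\<exists>t\<in>{0..1}. \<rho> i t \<ge> \<alpha>"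
  shows "\<exists>t\<^sub>0>0. \<forall>t\<in>{0..1}. \<rho> i t \<ge> \<alpha> \<longleftrightarrow> t \<ge> t\<^sub>0"
proof -
  let ?T = "{t\<in>{0..1}. \<rho> i t \<ge> \<alpha>}"
  define t0 where "t0 = Inf ?T"
  have ne: "?T \<noteq> {}" using T by blast
  have bdd: "bdd_below ?T" by (auto simp: bdd_below_def)
  have lower: "t0 \<le> t" if "t \<in> ?T" for t
    unfolding t0_def using that bdd by (rule cInf_lower)
  have "0 \<le> t0" unfolding t0_def using ne by (intro cInf_greatest) auto
  have "t0 \<le> 1" using T lower by force
  have attained: "\<rho> i t0 \<ge> \<alpha>"
  proof (rule ccontr)
    assume less: "\<not> \<rho> i t0 \<ge> \<alpha>"
    then have "t0 \<notin> ?T" by simp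
    then have "t0 \<noteq> 1" using T lower by (metis (mono_tags, lifting) antisym atLeastAtMost_iff mem_Collect_eq)
    then have "t0 \<in> {0..<1}" using \<open>0 \<le> t0\<close> \<open>t0 \<le> 1\<close> by simp
    then have "(\<rho> i \<longlongrightarrow> \<rho> i t0) (at_right t0)"
      using rho_right_continuous[OF i] by (simp add: continuous_within)
    then have "\<forall>\<^sub>F t in at_right t0. \<rho> i t < \<alpha>"
      using less by (intro order_tendstoD) auto
    then obtain b where b: "b > t0" "\<And>t. t0 < t \<Longrightarrow> t < b \<Longrightarrow> \<rho> i t < \<alpha>"
      unfolding eventually_at_right_field by blast
    obtain t where t: "t \<in> ?T" "t < b"
      using cInf_lessD[OF ne] b(1) unfolding t0_def by blast
    then have "t0 < t" using lower[OF t(1)] \<open>t0 \<notin> ?T\<close> by (metis order_le_less)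
    then show False using b(2) t by fastforce
  qed
  then have "t0 \<noteq> 0" using rho_zero[OF i] \<alpha> by auto
  with \<open>0 \<le> t0\<close> have "t0 > 0" by simp
  moreover have "\<rho> i t \<ge> \<alpha> \<longleftrightarrow> t \<ge> t0" if t: "t \<in> {0..1}" for t
    using lower[of t] rho_le[OF i \<open>0 \<le> t0\<close>, of t] attained t by auto
  ultimately show ?thesis by blast
qed

lemma compact_rho_level:
  assumes u: "levels_compact u" and i: "i \<in> I" and \<alpha>: "\<alpha> > 0"
  shows "compact {x. \<rho> i (u x) \<ge> \<alpha>}"
proof (cases "\<exists>t\<in>{0..1}. \<rho> i t \<ge> \<alpha>")
  case False
  then have "{x. \<rho> i (u x) \<ge> \<alpha>} = {}"
    using levels_compact_range[OF u] by blast
  then show ?thesis by (metis compact_empty)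
next
  case True
  then obtain t0 where t0: "t0 > 0" "\<And>t. t \<in> {0..1} \<Longrightarrow> \<rho> i t \<ge> \<alpha> \<longleftrightarrow> t \<ge> t0"
    using rho_superlevel[OF i \<alpha>] by blast
  then have "{x. \<rho> i (u x) \<ge> \<alpha>} = {x. u x \<ge> t0}"
    using levels_compact_range[OF u] by blast
  then show ?thesis using u t0(1) by (simp add: levels_compact_def)
qed

lemma hutchinson_upper:
  assumes u: "range u \<subseteq> {0..1}" and i: "i \<in> I"
  shows "\<rho> i (u x) \<le> hutchinson I f \<rho> u (f i x)"
proof -
  have "\<rho> i (u x) \<le> \<rho> i (fuzzy_image (f i) u (f i x))"
    using unit_range[OF u, of x] fuzzy_image_upper[OF u, of x "f i"] fuzzy_image_range[OF u, of "f i" "f i x"]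
    by (intro rho_le[OF i]) auto
  also have "\<dots> \<le> hutchinson I f \<rho> u (f i x)"
    unfolding hutchinson_def using finite_index i by (intro cSUP_upper) auto
  finally show ?thesis .
qed

lemma hutchinson_range:
  assumes u: "range u \<subseteq> {0..1}"
  shows "range (hutchinson I f \<rho> u) \<subseteq> {0..1}"
proof safe
  fix y
  have r: "\<rho> i (fuzzy_image (f i) u y) \<in> {0..1}" if "i \<in> I" for i
    using rho_in that fuzzy_image_range[OF u] by blast
  obtain i where i: "i \<in> I" using index_nonempty by blast
  have "\<rho> i (fuzzy_image (f i) u y) \<le> hutchinson I f \<rho> u y"
    unfolding hutchinson_def using finite_index i by (intro cSUP_upper) auto
  moreover have "hutchinson I f \<rho> u y \<le> 1"
    unfolding hutchinson_def using r index_nonempty by (intro cSUP_least) auto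
  ultimately show "hutchinson I f \<rho> u y \<in> {0..1}" using r[OF i] by auto
qed

text \<open>
  Attainment cannot be weakened to approximation: \<open>\<rho> i\<close> may jump at the supremum over the fiber,
  so points of nearly maximal value would not give the right value of \<open>\<rho> i\<close>.
\<close>

lemma hutchinson_attained:
  assumes u: "levels_compact u" and \<alpha>: "0 < \<alpha>" "\<alpha> \<le> hutchinson I f \<rho> u y"
  shows "\<exists>i\<in>I. \<exists>x. f i x = y \<and> \<rho> i (u x) \<ge> \<alpha>"
proof -
  have "hutchinson I f \<rho> u y \<in> (\<lambda>i. \<rho> i (fuzzy_image (f i) u y)) ` I"
    unfolding hutchinson_def using finite_index index_nonempty
    by (subst cSup_eq_Max) (auto intro!: Max_in)
  then obtain i where i: "i \<in> I" "\<rho> i (fuzzy_image (f i) u y) \<ge> \<alpha>"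
    using \<alpha> by auto
  have "fuzzy_image (f i) u y \<noteq> 0"
    using i \<alpha> rho_zero by fastforce
  then have "fuzzy_image (f i) u y > 0"
    using fuzzy_image_range[of u "f i" y] u by (auto simp: levels_compact_def)
  then show ?thesis
    using fuzzy_image_attained[OF u continuous_maps[OF i(1)]] i by metis
qed

lemma hutchinson_levels_compact:
  assumes u: "levels_compact u"
  shows "levels_compact (hutchinson I f \<rho> u)"
proof -
  have r: "range u \<subseteq> {0..1}" using u by (simp add: levels_compact_def)
  have "compact {y. hutchinson I f \<rho> u y \<ge> \<alpha>}" if \<alpha>: "\<alpha> > 0" for \<alpha>
  proof -
    have "{y. hutchinson I f \<rho> u y \<ge> \<alpha>} = (\<Union>i\<in>I. f i ` {x. \<rho> i (u x) \<ge> \<alpha>})"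
      using hutchinson_attained[OF u \<alpha>] hutchinson_upper[OF r]
      by (fastforce intro: order_trans)
    also have "compact \<dots>"
      using finite_index compact_rho_level[OF u _ \<alpha>] continuous_maps continuous_on_subset
      by (intro compact_UN compact_continuous_image) blast+
    finally show ?thesis .
  qed
  then show ?thesis using hutchinson_range[OF r] by (simp add: levels_compact_def)
qed

lemma iterate_levels_compact:
  "levels_compact u \<Longrightarrow> levels_compact ((hutchinson I f \<rho> ^^ n) u)"
  by (induction n) (auto intro: hutchinson_levels_compact)

lemma rho_word_range:
  "set \<sigma> \<subseteq> I \<Longrightarrow> t \<in> {0..1} \<Longrightarrow> foldr \<rho> \<sigma> t \<in> {0..1}"
proof (induction \<sigma>)
  case (Cons i \<sigma>)
  then show ?case using rho_in[of i "foldr \<rho> \<sigma> t"] by simp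
qed simp

lemma rho_word_mono:
  "set \<sigma> \<subseteq> I \<Longrightarrow> 0 \<le> s \<Longrightarrow> s \<le> t \<Longrightarrow> t \<le> 1 \<Longrightarrow> foldr \<rho> \<sigma> s \<le> foldr \<rho> \<sigma> t"
proof (induction \<sigma>)
  case (Cons i \<sigma>)
  then show ?case
    using rho_word_range[of \<sigma> s] rho_word_range[of \<sigma> t] by (auto intro!: rho_le)
qed simp

lemma rho_word_zero: "set \<sigma> \<subseteq> I \<Longrightarrow> foldr \<rho> \<sigma> 0 = 0"
  by (induction \<sigma>) (auto simp: rho_zero)

lemma continuous_word: "set \<sigma> \<subseteq> I \<Longrightarrow> continuous_on UNIV (foldr f \<sigma>)"
proof (induction \<sigma>)
  case (Cons i \<sigma>)
  then show ?case
    using continuous_maps[of i] by (auto simp: o_def intro: continuous_on_compose2)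
qed (simp add: id_def)

lemma iterate_lower:
  assumes u: "levels_compact u"
  shows "set \<sigma> \<subseteq> I \<Longrightarrow> foldr \<rho> \<sigma> (u x) \<le> (hutchinson I f \<rho> ^^ length \<sigma>) u (foldr f \<sigma> x)"
proof (induction \<sigma>)
  case (Cons i \<sigma>)
  let ?v = "(hutchinson I f \<rho> ^^ length \<sigma>) u"
  have v: "range ?v \<subseteq> {0..1}"
    using iterate_levels_compact[OF u] by (simp add: levels_compact_def)
  have "u x \<in> {0..1}" by (rule levels_compact_range[OF u])
  then have "foldr \<rho> \<sigma> (u x) \<in> {0..1}"
    using Cons by (intro rho_word_range) auto
  then have "\<rho> i (foldr \<rho> \<sigma> (u x)) \<le> \<rho> i (?v (foldr f \<sigma> x))"
    using Cons unit_range[OF v] by (intro rho_le) auto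
  also have "\<dots> \<le> hutchinson I f \<rho> ?v (f i (foldr f \<sigma> x))"
    using Cons by (intro hutchinson_upper[OF v]) auto
  finally show ?case by simp
qed simp

lemma iterate_attained:
  assumes u: "levels_compact u" and \<alpha>: "0 < \<alpha>"
  shows "\<alpha> \<le> (hutchinson I f \<rho> ^^ n) u z \<Longrightarrow>
    \<exists>\<sigma> x. length \<sigma> = n \<and> set \<sigma> \<subseteq> I \<and> foldr f \<sigma> x = z \<and> \<alpha> \<le> foldr \<rho> \<sigma> (u x)"
  using \<alpha>
proof (induction n arbitrary: \<alpha> z)
  case 0
  then show ?case by (intro exI[of _ "[]"]) auto
next
  case (Suc n)
  let ?v = "(hutchinson I f \<rho> ^^ n) u"
  have v: "levels_compact ?v" by (rule iterate_levels_compact[OF u])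
  obtain i y where i: "i \<in> I" "f i y = z" "\<alpha> \<le> \<rho> i (?v y)"
    using hutchinson_attained[OF v Suc.prems(2), of z] Suc.prems(1) by auto
  have "?v y \<noteq> 0" using i rho_zero Suc.prems(2) by fastforce
  then have vy: "?v y > 0" "?v y \<le> 1" using levels_compact_range[OF v, of y] by auto
  obtain \<sigma> x where \<sigma>: "length \<sigma> = n" "set \<sigma> \<subseteq> I" "foldr f \<sigma> x = y" "?v y \<le> foldr \<rho> \<sigma> (u x)"
    using Suc.IH[OF order_refl vy(1)] by blast
  have "u x \<in> {0..1}" by (rule levels_compact_range[OF u])
  then have "foldr \<rho> \<sigma> (u x) \<in> {0..1}" using \<sigma> by (intro rho_word_range)
  then have "\<rho> i (?v y) \<le> \<rho> i (foldr \<rho> \<sigma> (u x))"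
    using \<sigma> vy by (intro rho_le[OF i(1)]) auto
  then show ?case using \<sigma> i by (intro exI[of _ "i # \<sigma>"] exI[of _ x]) auto
qed

section \<open>Contraction along orbits\<close>

definition ratio :: real where
  "ratio = (SOME C. 0 \<le> C \<and> C < 1 \<and>
    (\<forall>i\<in>I. \<forall>x. \<forall>y\<in>orbit I f x. \<forall>z\<in>orbit I f x. dist (f i y) (f i z) \<le> C * dist y z))"

lemma ratio:
  "0 \<le> ratio" "ratio < 1"
  "i \<in> I \<Longrightarrow> y \<in> orbit I f x \<Longrightarrow> z \<in> orbit I f x \<Longrightarrow> dist (f i y) (f i z) \<le> ratio * dist y z"
  using someI_ex[OF orbital_contraction] unfolding ratio_def[symmetric] by blast+

lemma word_in_orbit: "set \<sigma> \<subseteq> I \<Longrightarrow> foldr f \<sigma> x \<in> orbit I f x"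
  unfolding orbit_def by (cases "\<sigma> = []") auto

lemma map_in_orbit:
  assumes i: "i \<in> I" and y: "y \<in> orbit I f x"
  shows "f i y \<in> orbit I f x"
proof -
  obtain \<sigma> where "set \<sigma> \<subseteq> I" "y = foldr f \<sigma> x"
    using y unfolding orbit_def by (auto intro: that[of "[]"] that)
  then show ?thesis using word_in_orbit[of "i # \<sigma>" x] i by simp
qed

lemma map_in_orbit_closure:
  assumes i: "i \<in> I" and y: "y \<in> closure (orbit I f x)"
  shows "f i y \<in> closure (orbit I f x)"
proof -
  have "f i ` closure (orbit I f x) \<subseteq> closure (orbit I f x)"
  proof (rule image_closure_subset)
    show "continuous_on (closure (orbit I f x)) (f i)"
      by (rule continuous_on_subset[OF continuous_maps[OF i]]) simp
    show "f i ` orbit I f x \<subseteq> closure (orbit I f x)"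
      using map_in_orbit[OF i] closure_subset[of "orbit I f x"] by blast
  qed simp
  then show ?thesis using y by blast
qed

text \<open>
  Restricting a fuzzy set to a closed orbit leaves points outside the orbit itself, so the
  contraction is needed on the closure, where it holds by continuity.
\<close>

lemma orbit_closure_contraction:
  assumes i: "i \<in> I" and y: "y \<in> closure (orbit I f x)" and z: "z \<in> closure (orbit I f x)"
  shows "dist (f i y) (f i z) \<le> ratio * dist y z"
proof -
  obtain a b where a: "\<And>n. a n \<in> orbit I f x" "a \<longlonglongrightarrow> y" and b: "\<And>n. b n \<in> orbit I f x" "b \<longlonglongrightarrow> z"
    using y z unfolding closure_sequential by blast
  have cont: "isCont (f i) t" for t
    using continuous_maps[OF i] by (simp add: continuous_on_eq_continuous_at)
  show ?thesis
  proof (rule LIMSEQ_le)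
    show "(\<lambda>n. dist (f i (a n)) (f i (b n))) \<longlonglongrightarrow> dist (f i y) (f i z)"
      by (intro tendsto_dist isCont_tendsto_compose[OF cont] a b)
    show "(\<lambda>n. ratio * dist (a n) (b n)) \<longlonglongrightarrow> ratio * dist y z"
      by (intro tendsto_intros a b)
    show "\<exists>N. \<forall>n\<ge>N. dist (f i (a n)) (f i (b n)) \<le> ratio * dist (a n) (b n)"
      using ratio(3)[OF i a(1) b(1)] by blast
  qed
qed

lemma word_in_orbit_closure:
  "set \<sigma> \<subseteq> I \<Longrightarrow> y \<in> closure (orbit I f x) \<Longrightarrow> foldr f \<sigma> y \<in> closure (orbit I f x)"
  by (induction \<sigma>) (auto intro: map_in_orbit_closure)

lemma word_contraction:
  assumes "y \<in> closure (orbit I f x)" "z \<in> closure (orbit I f x)"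
  shows "set \<sigma> \<subseteq> I \<Longrightarrow> dist (foldr f \<sigma> y) (foldr f \<sigma> z) \<le> ratio ^ length \<sigma> * dist y z"
proof (induction \<sigma>)
  case (Cons i \<sigma>)
  have "dist (f i (foldr f \<sigma> y)) (f i (foldr f \<sigma> z)) \<le> ratio * dist (foldr f \<sigma> y) (foldr f \<sigma> z)"
    using Cons assms by (intro orbit_closure_contraction[of _ _ x] word_in_orbit_closure) auto
  also have "\<dots> \<le> ratio * (ratio ^ length \<sigma> * dist y z)"
    using Cons ratio(1) by (intro mult_left_mono) auto
  finally show ?case by (simp add: mult.assoc)
qed simp

lemma point_in_orbit_closure: "x \<in> closure (orbit I f x)"
  using word_in_orbit[of "[]" x] closure_subset by auto

end

section \<open>The attractor of a compact set of seeds\<close>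

context orbital_fuzzy_ifs
begin

text \<open>
  The words of length \<open>n\<close> along which a point of value 1 keeps at least the value \<open>\<alpha>\<close>.
\<close>

definition words :: "nat \<Rightarrow> real \<Rightarrow> 'i list set" where
  "words n \<alpha> = {\<sigma>. set \<sigma> \<subseteq> I \<and> length \<sigma> = n \<and> \<alpha> \<le> foldr \<rho> \<sigma> 1}"

text \<open>
  A point of this set is the limit of \<open>f\<^sub>\<sigma> a\<close> along longer and longer words; giving the rate of
  approach explicitly avoids speaking about infinite words.
\<close>

definition attractor_level :: "'a set \<Rightarrow> real \<Rightarrow> real \<Rightarrow> 'a set" where
  "attractor_level A K \<alpha> =
    {z. \<exists>a\<in>A. \<forall>n. \<exists>\<sigma>\<in>words n \<alpha>. dist z (foldr f \<sigma> a) \<le> K * ratio ^ n}"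

text \<open>
  The alternative \<open>\<alpha> = 0\<close> makes the value 0 at points that lie in no level.
\<close>

definition attractor :: "'a set \<Rightarrow> real \<Rightarrow> 'a \<Rightarrow> real" where
  "attractor A K z = Sup {\<alpha>\<in>{0..1}. \<alpha> = 0 \<or> z \<in> attractor_level A K \<alpha>}"

lemma finite_words: "finite (words n \<alpha>)"
proof -
  have "words n \<alpha> \<subseteq> {\<sigma>. set \<sigma> \<subseteq> I \<and> length \<sigma> = n}" by (auto simp: words_def)
  then show ?thesis
    using finite_lists_length_eq[OF finite_index] finite_subset by blast
qed

lemma words_antimono: "\<alpha> \<le> \<beta> \<Longrightarrow> words n \<beta> \<subseteq> words n \<alpha>"
  by (auto simp: words_def)

lemma attractor_level_antimono:
  "\<alpha> \<le> \<beta> \<Longrightarrow> attractor_level A K \<beta> \<subseteq> attractor_level A K \<alpha>"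
  unfolding attractor_level_def using words_antimono by blast

lemma attractor_level_mono:
  "A \<subseteq> B \<Longrightarrow> attractor_level A K \<alpha> \<subseteq> attractor_level B K \<alpha>"
  unfolding attractor_level_def by blast

text \<open>
  There are finitely many words of length \<open>n\<close>, hence finitely many values \<open>\<rho>\<^sub>\<sigma> 1\<close>, and one can
  descend from \<open>\<alpha>\<close> a little without meeting a new one.
\<close>

lemma words_left_continuous:
  "\<exists>\<beta><\<alpha>. \<forall>\<gamma>>\<beta>. words n \<gamma> \<subseteq> words n \<alpha>"
proof -
  let ?V = "{t \<in> (\<lambda>\<sigma>. foldr \<rho> \<sigma> 1) ` {\<sigma>. set \<sigma> \<subseteq> I \<and> length \<sigma> = n}. t < \<alpha>}"
  have fin: "finite ?V" using finite_lists_length_eq[OF finite_index] by simp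
  define \<beta> where "\<beta> = Max (insert (\<alpha> - 1) ?V)"
  have "\<beta> < \<alpha>" unfolding \<beta>_def using fin by (subst Max_less_iff) auto
  moreover have "\<sigma> \<in> words n \<alpha>" if "\<gamma> > \<beta>" "\<sigma> \<in> words n \<gamma>" for \<gamma> \<sigma>
  proof (rule ccontr)
    assume "\<sigma> \<notin> words n \<alpha>"
    then have "foldr \<rho> \<sigma> 1 \<in> ?V" using that by (auto simp: words_def)
    then have "foldr \<rho> \<sigma> 1 \<le> \<beta>" unfolding \<beta>_def using fin by (intro Max_ge) auto
    then show False using that by (auto simp: words_def)
  qed
  ultimately show ?thesis by blast
qed

lemma rho_word_append_le:
  assumes "set (\<sigma> @ \<tau>) \<subseteq> I"
  shows "foldr \<rho> (\<sigma> @ \<tau>) 1 \<le> foldr \<rho> \<sigma> 1"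
  using assms rho_word_range[of \<tau> 1] by (auto intro!: rho_word_mono)

lemma attractor_range: "attractor A K z \<in> {0..1}"
proof -
  let ?S = "{\<alpha>\<in>{0..1}. \<alpha> = 0 \<or> z \<in> attractor_level A K \<alpha>}"
  have "0 \<le> Sup ?S" by (rule cSup_upper) (auto simp: bdd_above_def)
  moreover have "Sup ?S \<le> 1" by (rule cSup_least) (auto intro: exI[of _ "0::real"])
  ultimately show ?thesis by (simp add: attractor_def)
qed

lemma attractor_upper:
  "z \<in> attractor_level A K \<alpha> \<Longrightarrow> 0 \<le> \<alpha> \<Longrightarrow> \<alpha> \<le> 1 \<Longrightarrow> \<alpha> \<le> attractor A K z"
  unfolding attractor_def by (rule cSup_upper) (auto simp: bdd_above_def)

lemma attractor_mono:
  assumes "A \<subseteq> B"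
  shows "attractor A K z \<le> attractor B K z"
  unfolding attractor_def
  using attractor_level_mono[OF assms]
  by (intro cSup_subset_mono) (auto simp: bdd_above_def intro: exI[of _ "0::real"])

end

text \<open>
  The factor \<open>1 - ratio\<close> is chosen so that the geometric series of successive displacements of a seed
  sums to at most \<open>K\<close>.
\<close>

locale orbital_seeds = orbital_fuzzy_ifs I f \<rho>
  for I :: "'i set" and f :: "'i \<Rightarrow> 'a::complete_space \<Rightarrow> 'a" and \<rho> +
  fixes A :: "'a set" and K :: real
  assumes seeds_compact: "compact A" and seeds_nonempty: "A \<noteq> {}"
    and K_nonneg: "0 \<le> K"
    and seed_step: "a \<in> A \<Longrightarrow> i \<in> I \<Longrightarrow> dist (f i a) a \<le> K * (1 - ratio)"
begin

text \<open>
  The innermost letter acts first, so appending a letter to a word moves the seed one step along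
  its own orbit before the word contracts that step. Writing the bound as a difference makes it
  telescope.
\<close>

lemma word_step:
  assumes a: "a \<in> A" and \<sigma>: "set (\<sigma> @ [i]) \<subseteq> I"
  shows "dist (foldr f (\<sigma> @ [i]) a) (foldr f \<sigma> a) \<le> K * ratio ^ length \<sigma> - K * ratio ^ Suc (length \<sigma>)"
proof -
  have "dist (foldr f \<sigma> (f i a)) (foldr f \<sigma> a) \<le> ratio ^ length \<sigma> * dist (f i a) a"
    using \<sigma> by (intro word_contraction[of _ a] map_in_orbit_closure point_in_orbit_closure) auto
  also have "\<dots> \<le> ratio ^ length \<sigma> * (K * (1 - ratio))"
    using seed_step[OF a] \<sigma> ratio(1) by (intro mult_left_mono) auto
  finally show ?thesis by (simp add: algebra_simps)
qed

lemma word_prefix: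
  assumes a: "a \<in> A"
  shows "set (\<sigma> @ \<tau>) \<subseteq> I \<Longrightarrow> dist (foldr f (\<sigma> @ \<tau>) a) (foldr f \<sigma> a) \<le> K * ratio ^ length \<sigma>"
proof -
  assume \<tau>: "set (\<sigma> @ \<tau>) \<subseteq> I"
  have "dist (foldr f (\<sigma> @ \<tau>) a) (foldr f \<sigma> a) \<le> K * ratio ^ length \<sigma> - K * ratio ^ length (\<sigma> @ \<tau>)"
    using \<tau>
  proof (induction \<tau> rule: rev_induct)
    case (snoc i \<tau>)
    have "set ((\<sigma> @ \<tau>) @ [i]) \<subseteq> I" using snoc.prems by simp
    from word_step[OF a this]
    have "dist (foldr f (\<sigma> @ \<tau> @ [i]) a) (foldr f (\<sigma> @ \<tau>) a)
      \<le> K * ratio ^ length (\<sigma> @ \<tau>) - K * ratio ^ length (\<sigma> @ \<tau> @ [i])" by simp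
    moreover have "dist (foldr f (\<sigma> @ \<tau>) a) (foldr f \<sigma> a) \<le> K * ratio ^ length \<sigma> - K * ratio ^ length (\<sigma> @ \<tau>)"
      using snoc by simp
    ultimately show ?case
      using dist_triangle[of "foldr f (\<sigma> @ \<tau> @ [i]) a" "foldr f \<sigma> a" "foldr f (\<sigma> @ \<tau>) a"] by linarith
  qed simp
  moreover have "0 \<le> K * ratio ^ length (\<sigma> @ \<tau>)" using K_nonneg ratio(1) by simp
  ultimately show ?thesis by linarith
qed

lemma ratio_power_limit: "(\<lambda>n. c * ratio ^ n) \<longlonglongrightarrow> 0"
  using ratio by (intro tendsto_mult_right_zero LIMSEQ_power_zero) auto

text \<open>
  Appending copies of an index \<open>j\<close> with \<open>\<rho> j 1 = 1\<close> to a word loses no value, and the images of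
  the seed under the extended words converge.
\<close>

lemma attractor_level_near_word:
  assumes a: "a \<in> A" and \<sigma>: "\<sigma> \<in> words n \<alpha>"
  shows "\<exists>z\<in>attractor_level A K \<alpha>. dist (foldr f \<sigma> a) z \<le> K * ratio ^ n"
proof -
  obtain j where j: "j \<in> I" "\<rho> j 1 = 1" using rho_one by blast
  have jj: "foldr \<rho> (replicate m j) 1 = 1" for m
    by (induction m) (auto simp: j)
  have \<sigma>': "set \<sigma> \<subseteq> I" "length \<sigma> = n" "\<alpha> \<le> foldr \<rho> \<sigma> 1"
    using \<sigma> by (auto simp: words_def)
  \<comment> \<open>the prefixes \<open>pre p\<close> of the extended words are the witnesses for every length\<close>
  define ext where "ext = (\<lambda>m. \<sigma> @ replicate m j)"
  define pre where "pre = (\<lambda>p. take p (ext p))"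
  have ext_I: "set (ext m) \<subseteq> I" for m using \<sigma>' j by (auto simp: ext_def)
  have ext_split: "ext m = pre p @ drop p (ext m)" if "p \<le> m" for p m
  proof -
    have "take p (ext m) = pre p" using that by (auto simp: ext_def pre_def min_def)
    then show ?thesis by (metis append_take_drop_id)
  qed
  have pre_word: "pre p \<in> words p \<alpha>" for p
  proof -
    have "set (pre p) \<subseteq> I" using ext_I[of p] by (auto simp: pre_def dest: in_set_takeD)
    moreover have "length (pre p) = p" by (simp add: pre_def ext_def)
    moreover have "foldr \<rho> (ext p) 1 \<le> foldr \<rho> (pre p) 1"
      using rho_word_append_le[of "pre p" "drop p (ext p)"] ext_split[of p p] ext_I[of p] by simp
    moreover have "foldr \<rho> (ext p) 1 = foldr \<rho> \<sigma> 1" using jj by (simp add: ext_def)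
    ultimately show ?thesis using \<sigma>' by (simp add: words_def)
  qed
  define x where "x = (\<lambda>m. foldr f (ext m) a)"
  have near: "dist (x m) (foldr f (pre p) a) \<le> K * ratio ^ p" if "p \<le> m" for p m
    using word_prefix[OF a, of "pre p" "drop p (ext m)"] ext_split[OF that] ext_I[of m] pre_word[of p]
    by (simp add: x_def words_def)
  have "Cauchy x"
  proof (rule metric_CauchyI)
    fix e :: real assume "e > 0"
    then have "\<forall>\<^sub>F p in sequentially. (2 * K) * ratio ^ p < e"
      by (intro order_tendstoD[OF ratio_power_limit])
    then obtain p where p: "(2 * K) * ratio ^ p < e"
      by (auto simp: eventually_sequentially)
    have "dist (x m) (x m') < e" if "p \<le> m" "p \<le> m'" for m m'
      using near[OF that(1)] near[OF that(2)] p dist_triangle2[of "x m" "x m'" "foldr f (pre p) a"]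
      by linarith
    then show "\<exists>M. \<forall>m\<ge>M. \<forall>n\<ge>M. dist (x m) (x n) < e" by blast
  qed
  then obtain z where z: "x \<longlonglongrightarrow> z"
    using Cauchy_convergent convergent_def by blast
  have z_near: "dist z (foldr f (pre p) a) \<le> K * ratio ^ p" for p
  proof (rule LIMSEQ_le_const2)
    show "(\<lambda>m. dist (x m) (foldr f (pre p) a)) \<longlonglongrightarrow> dist z (foldr f (pre p) a)"
      by (intro tendsto_intros z)
    show "\<exists>N. \<forall>m\<ge>N. dist (x m) (foldr f (pre p) a) \<le> K * ratio ^ p"
      using near by blast
  qed
  have "z \<in> attractor_level A K \<alpha>"
    unfolding attractor_level_def using a z_near pre_word by blast
  moreover have "pre n = \<sigma>" using \<sigma>' by (simp add: pre_def ext_def)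
  ultimately show ?thesis using z_near[of n] by (metis dist_commute)
qed

text \<open>
  The quantifiers over seeds and over lengths may be exchanged: for a fixed point \<open>z\<close> the seeds
  admissible for length \<open>n\<close> form a compact set, and by \<open>word_step\<close> these sets decrease with \<open>n\<close>.
\<close>

lemma attractor_level_eq_Inter:
  "attractor_level A K \<alpha> = {z. \<forall>n. \<exists>a\<in>A. \<exists>\<sigma>\<in>words n \<alpha>. dist z (foldr f \<sigma> a) \<le> K * ratio ^ n}"
proof (intro set_eqI iffI)
  fix z assume "z \<in> {z. \<forall>n. \<exists>a\<in>A. \<exists>\<sigma>\<in>words n \<alpha>. dist z (foldr f \<sigma> a) \<le> K * ratio ^ n}"
  then have ex: "\<exists>a\<in>A. \<exists>\<sigma>\<in>words n \<alpha>. dist z (foldr f \<sigma> a) \<le> K * ratio ^ n" for n by blast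
  define F where "F = (\<lambda>n. A \<inter> (\<Union>\<sigma>\<in>words n \<alpha>. {a. dist z (foldr f \<sigma> a) \<le> K * ratio ^ n}))"
  have "\<exists>a. \<forall>n. a \<in> F n"
  proof (rule compact_nested_nonempty)
    fix n
    show "F n \<noteq> {}" using ex[of n] by (auto simp: F_def)
    have "closed {a. dist z (foldr f \<sigma> a) \<le> K * ratio ^ n}" if "\<sigma> \<in> words n \<alpha>" for \<sigma>
      using that by (intro closed_Collect_le continuous_intros continuous_word) (auto simp: words_def)
    then show "compact (F n)"
      unfolding F_def using seeds_compact finite_words by (intro compact_Int_closed closed_UN) auto
    show "F (Suc n) \<subseteq> F n"
    proof
      fix a assume "a \<in> F (Suc n)"
      then obtain \<tau> where a: "a \<in> A" and \<tau>: "\<tau> \<in> words (Suc n) \<alpha>" "dist z (foldr f \<tau> a) \<le> K * ratio ^ Suc n"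
        by (auto simp: F_def)
      then have "length \<tau> = Suc n" by (simp add: words_def)
      then obtain \<sigma> i where \<sigma>: "\<tau> = \<sigma> @ [i]" "length \<sigma> = n"
        by (auto simp: length_Suc_conv_rev)
      have I: "set (\<sigma> @ [i]) \<subseteq> I" using \<tau> \<sigma> by (simp add: words_def)
      have "\<sigma> \<in> words n \<alpha>"
        using rho_word_append_le[OF I] \<tau> \<sigma> by (auto simp: words_def)
      moreover have "dist z (foldr f \<sigma> a) \<le> K * ratio ^ n"
        using word_step[OF a I] \<tau>(2) \<sigma> dist_triangle[of z "foldr f \<sigma> a" "foldr f \<tau> a"] by auto
      ultimately show "a \<in> F n" using a by (auto simp: F_def)
    qed
  qed
  then obtain a where a: "\<And>n. a \<in> F n" by blast
  then show "z \<in> attractor_level A K \<alpha>"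
    unfolding attractor_level_def F_def by blast
qed (unfold attractor_level_def, blast)

text \<open>
  For a single word, compactness of the seed set turns the existence of a near seed into a bound
  on the infimal distance to a compact image, which is a closed condition.
\<close>

lemma attractor_level_closed: "closed (attractor_level A K \<alpha>)"
proof -
  have near: "{z. \<exists>a\<in>A. dist z (foldr f \<sigma> a) \<le> r} = {z. infdist z (foldr f \<sigma> ` A) \<le> r}"
    if \<sigma>: "set \<sigma> \<subseteq> I" for \<sigma> r
  proof (intro set_eqI iffI; clarsimp)
    fix z a assume "a \<in> A" "dist z (foldr f \<sigma> a) \<le> r"
    then show "infdist z (foldr f \<sigma> ` A) \<le> r" by (intro infdist_le2) auto
  next
    fix z assume le: "infdist z (foldr f \<sigma> ` A) \<le> r"
    have "continuous_on A (\<lambda>a. dist z (foldr f \<sigma> a))"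
      by (intro continuous_intros continuous_on_subset[OF continuous_word[OF \<sigma>]]) simp
    then obtain a where a: "a \<in> A" "\<And>b. b \<in> A \<Longrightarrow> dist z (foldr f \<sigma> a) \<le> dist z (foldr f \<sigma> b)"
      using continuous_attains_inf[OF seeds_compact seeds_nonempty] by blast
    then have "dist z (foldr f \<sigma> a) \<le> infdist z (foldr f \<sigma> ` A)"
      using seeds_nonempty by (auto simp: infdist_def image_image intro!: cINF_greatest)
    then show "\<exists>a\<in>A. dist z (foldr f \<sigma> a) \<le> r" using a le by force
  qed
  have "attractor_level A K \<alpha> =
      (\<Inter>n. \<Union>\<sigma>\<in>words n \<alpha>. {z. \<exists>a\<in>A. dist z (foldr f \<sigma> a) \<le> K * ratio ^ n})"
    unfolding attractor_level_eq_Inter by blast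
  also have "closed \<dots>"
  proof (intro closed_INT ballI closed_UN finite_words)
    fix n \<sigma> assume "\<sigma> \<in> words n \<alpha>"
    then have "set \<sigma> \<subseteq> I" by (simp add: words_def)
    then show "closed {z. \<exists>a\<in>A. dist z (foldr f \<sigma> a) \<le> K * ratio ^ n}"
      by (subst near) (auto intro!: closed_Collect_le continuous_intros)
  qed
  finally show ?thesis .
qed

text \<open>
  The space is only complete, so compactness comes from total boundedness: up to a small error the
  level is a finite union of continuous images of the compact seed set.
\<close>

lemma attractor_level_compact: "compact (attractor_level A K \<alpha>)"
  unfolding compact_eq_totally_bounded
proof (intro conjI allI impI)
  show "complete (attractor_level A K \<alpha>)"
    using attractor_level_closed complete_eq_closed by blast
  fix e :: real assume e: "e > 0"
  then have "\<forall>\<^sub>F n in sequentially. K * ratio ^ n < e / 2"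
    by (intro order_tendstoD[OF ratio_power_limit]) simp
  then obtain n where n: "K * ratio ^ n < e / 2"
    by (auto simp: eventually_sequentially)
  let ?S = "\<Union>\<sigma>\<in>words n \<alpha>. foldr f \<sigma> ` A"
  have "compact ?S"
    using continuous_word seeds_compact
    by (intro compact_UN finite_words compact_continuous_image) (auto simp: words_def intro: continuous_on_subset)
  then obtain k where k: "finite k" "?S \<subseteq> (\<Union>x\<in>k. ball x (e / 2))"
    using e unfolding compact_eq_totally_bounded by (metis half_gt_zero)
  have "attractor_level A K \<alpha> \<subseteq> (\<Union>x\<in>k. ball x e)"
  proof
    fix z assume "z \<in> attractor_level A K \<alpha>"
    then obtain a \<sigma> where a: "a \<in> A" "\<sigma> \<in> words n \<alpha>" "dist z (foldr f \<sigma> a) \<le> K * ratio ^ n"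
      unfolding attractor_level_def by blast
    then obtain x where x: "x \<in> k" "dist x (foldr f \<sigma> a) < e / 2"
      using k(2) by (force simp: subset_iff)
    then have "dist x z < e"
      using a(3) n dist_triangle2[of x z "foldr f \<sigma> a"] by linarith
    then show "z \<in> (\<Union>x\<in>k. ball x e)" using x by auto
  qed
  then show "\<exists>k. finite k \<and> attractor_level A K \<alpha> \<subseteq> (\<Union>x\<in>k. ball x e)"
    using k(1) by blast
qed

text \<open>
  The supremum defining the attractor is attained: a point lying in the levels just below \<open>\<alpha>\<close>
  satisfies the condition for each length \<open>n\<close> at height \<open>\<alpha>\<close> by \<open>words_left_continuous\<close>, and the
  conditions for the separate lengths combine by \<open>attractor_level_eq_Inter\<close>.
\<close>

lemma attractor_ge_iff:
  assumes \<alpha>: "0 < \<alpha>" "\<alpha> \<le> 1"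
  shows "\<alpha> \<le> attractor A K z \<longleftrightarrow> z \<in> attractor_level A K \<alpha>"
proof
  assume "z \<in> attractor_level A K \<alpha>"
  then show "\<alpha> \<le> attractor A K z" using attractor_upper \<alpha> by auto
next
  assume ge: "\<alpha> \<le> attractor A K z"
  have "\<exists>a\<in>A. \<exists>\<sigma>\<in>words n \<alpha>. dist z (foldr f \<sigma> a) \<le> K * ratio ^ n" for n
  proof -
    obtain \<beta> where \<beta>: "\<beta> < \<alpha>" "\<And>\<gamma>. \<gamma> > \<beta> \<Longrightarrow> words n \<gamma> \<subseteq> words n \<alpha>"
      using words_left_continuous by blast
    \<comment> \<open>the maximum with 0 excludes the default member 0 of the set under the supremum\<close>
    have "max \<beta> 0 < Sup {\<alpha>\<in>{0..1}. \<alpha> = 0 \<or> z \<in> attractor_level A K \<alpha>}"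
      using ge \<beta>(1) \<alpha> by (simp add: attractor_def)
    then obtain \<gamma> where \<gamma>: "\<gamma> \<in> {\<alpha>\<in>{0..1}. \<alpha> = 0 \<or> z \<in> attractor_level A K \<alpha>}" "max \<beta> 0 < \<gamma>"
      by (rule less_cSupE) (auto intro: exI[of _ "0::real"])
    then have "z \<in> attractor_level A K \<gamma>" "\<gamma> > \<beta>" by auto
    then show ?thesis
      using \<beta>(2) unfolding attractor_level_def by blast
  qed
  then show "z \<in> attractor_level A K \<alpha>" unfolding attractor_level_eq_Inter by blast
qed

lemma attractor_normal: "\<exists>z. attractor A K z = 1"
proof -
  obtain a where "a \<in> A" using seeds_nonempty by blast
  then obtain z where "z \<in> attractor_level A K 1"
    using attractor_level_near_word[of a "[]" 0 1] by (auto simp: words_def)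
  then have "1 \<le> attractor A K z" using attractor_ge_iff by simp
  then show ?thesis using attractor_range[of A K z] by (intro exI[of _ z]) auto
qed

lemma attractor_fuzzy_compact_usc: "attractor A K \<in> fuzzy_compact_usc"
proof -
  have "positive_set (attractor A K) \<subseteq> attractor_level A K 0"
  proof
    fix z assume z: "z \<in> positive_set (attractor A K)"
    then have "z \<in> attractor_level A K (attractor A K z)"
      using attractor_ge_iff[of "attractor A K z" z] attractor_range[of A K z] by (simp add: positive_set_def)
    then show "z \<in> attractor_level A K 0"
      using attractor_level_antimono[of 0 "attractor A K z"] attractor_range[of A K z] by auto
  qed
  then have "closure (positive_set (attractor A K)) \<subseteq> attractor_level A K 0"
    using attractor_level_closed closure_minimal by blast
  then have "compact (closure (positive_set (attractor A K)))"
    using attractor_level_compact[of 0] by (metis closed_closure compact_Int_closed inf.absorb_iff2)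
  moreover have "closed {z. \<alpha> \<le> attractor A K z}" for \<alpha>
  proof -
    consider "\<alpha> \<le> 0" | "\<alpha> > 1" | "0 < \<alpha>" "\<alpha> \<le> 1" by linarith
    then show ?thesis
    proof cases
      case 1
      then have "\<alpha> \<le> attractor A K z" for z using attractor_range[of A K z] by simp
      then show ?thesis by simp
    next
      case 2
      then have "\<not> \<alpha> \<le> attractor A K z" for z using attractor_range[of A K z] by simp
      then show ?thesis by simp
    next
      case 3
      then show ?thesis using attractor_ge_iff[OF 3] attractor_level_closed by simp
    qed
  qed
  moreover have "range (attractor A K) \<subseteq> {0..1}" using attractor_range by blast
  ultimately show ?thesis
    using attractor_normal
    by (simp add: fuzzy_compact_usc_def fuzzy_compact_def level_set_def upper_semicontinuous_iff_closed)
qed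

text \<open>
  The levels of the \<open>n\<close>-th iterate and of the attractor are within \<open>(D + K) * ratio ^ n\<close> of each
  other, where \<open>D\<close> bounds the diameter of the support: \<open>D\<close> pays for replacing a point by a seed in the
  same closed orbit, and \<open>K\<close> for passing from a word to its limit points. The hypothesis asks for closed
  orbits so that it covers both \<open>u\<close> and its restrictions.
\<close>

lemma hutchinson_lim_eq_attractor:
  assumes u: "u \<in> fuzzy_compact_usc"
    and orbital: "\<And>x. u x > 0 \<Longrightarrow> \<exists>w y. x \<in> closure (orbit I f w) \<and> y \<in> closure (orbit I f w) \<and> u y = 1"
    and A: "A = {x. u x = 1}"
  shows "hutchinson_lim I f \<rho> u = attractor A K"
proof -
  let ?Z = "\<lambda>n. (hutchinson I f \<rho> ^^ n) u"
  have lc: "levels_compact u" using fuzzy_compact_usc_levels_compact[OF u] .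
  have Z01: "?Z n z \<le> 1" for n z
    using iterate_levels_compact[OF lc, of n] unfolding levels_compact_def image_subset_iff by auto
  have "bounded (closure (positive_set u))"
    using compact_imp_bounded[OF fuzzy_compact_usc_support[OF u]] .
  then obtain D where D: "\<And>x y. x \<in> closure (positive_set u) \<Longrightarrow> y \<in> closure (positive_set u) \<Longrightarrow> dist x y \<le> D"
    unfolding bounded_two_points by blast
  then have D: "dist x y \<le> D" if "u x > 0" "u y > 0" for x y
    using that closure_subset[of "positive_set u"] by (auto simp: positive_set_def)
  obtain a0 where a0: "a0 \<in> A" using seeds_nonempty by blast
  have D0: "0 \<le> D" using D[of a0 a0] a0 A by simp
  have lower: "\<alpha> \<le> ?Z n (foldr f \<sigma> a)" if "a \<in> A" "\<sigma> \<in> words n \<alpha>" for a \<sigma> n \<alpha>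
    using that A iterate_lower[OF lc, of \<sigma> a] by (auto simp: words_def)
  show ?thesis
    unfolding hutchinson_lim_def
  proof (rule fuzzy_lim_eqI)
    show "attractor A K \<in> fuzzy_compact_usc" by (rule attractor_fuzzy_compact_usc)
    show "(\<lambda>n. (D + K) * ratio ^ n) \<longlonglongrightarrow> 0" by (rule ratio_power_limit)
    fix n
    obtain z1 where "attractor A K z1 = 1" using attractor_normal by blast
    then have "z1 \<in> attractor_level A K 1" using attractor_ge_iff[of 1 z1] by simp
    then obtain a \<sigma> where "a \<in> A" "\<sigma> \<in> words n 1" unfolding attractor_level_def by blast
    from lower[OF this] show "\<exists>x. ?Z n x = 1" using Z01 antisym by blast
    show "levels_within (attractor A K) (?Z n) ((D + K) * ratio ^ n)"
      unfolding levels_within_def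
    proof (intro allI impI)
      fix z assume pos: "attractor A K z > 0"
      have "z \<in> attractor_level A K (attractor A K z)"
        using attractor_ge_iff[OF pos, of z] attractor_range[of A K z] by simp
      then obtain a \<sigma> where a: "a \<in> A" "\<sigma> \<in> words n (attractor A K z)"
          "dist z (foldr f \<sigma> a) \<le> K * ratio ^ n"
        unfolding attractor_level_def by blast
      have "K * ratio ^ n \<le> (D + K) * ratio ^ n"
        using D0 ratio(1) by (intro mult_right_mono) auto
      then show "\<exists>z'. attractor A K z \<le> ?Z n z' \<and> dist z z' \<le> (D + K) * ratio ^ n"
        using lower[OF a(1,2)] a(3) by (intro exI[of _ "foldr f \<sigma> a"]) auto
    qed
    show "levels_within (?Z n) (attractor A K) ((D + K) * ratio ^ n)"
      unfolding levels_within_def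
    proof (intro allI impI)
      fix z assume pos: "?Z n z > 0"
      obtain \<sigma> x where \<sigma>: "length \<sigma> = n" "set \<sigma> \<subseteq> I" "foldr f \<sigma> x = z" "?Z n z \<le> foldr \<rho> \<sigma> (u x)"
        using iterate_attained[OF lc pos order_refl] by blast
      have ux: "0 \<le> u x" "u x \<le> 1" using fuzzy_compact_usc_range[OF u] by auto
      have "u x \<noteq> 0" using \<sigma> pos rho_word_zero[of \<sigma>] by auto
      then have "u x > 0" using ux by simp
      then obtain w y where y: "x \<in> closure (orbit I f w)" "y \<in> closure (orbit I f w)" "u y = 1"
        using orbital by blast
      have "?Z n z \<le> foldr \<rho> \<sigma> 1" using \<sigma> rho_word_mono[of \<sigma> "u x" 1] ux by simp
      then have "\<sigma> \<in> words n (?Z n z)" using \<sigma> by (simp add: words_def)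
      moreover have "y \<in> A" using y A by simp
      ultimately obtain z' where z': "z' \<in> attractor_level A K (?Z n z)" "dist (foldr f \<sigma> y) z' \<le> K * ratio ^ n"
        using attractor_level_near_word by blast
      have "dist z (foldr f \<sigma> y) \<le> ratio ^ n * dist x y"
        using word_contraction[OF y(1,2) \<sigma>(2)] \<sigma> by simp
      also have "\<dots> \<le> ratio ^ n * D"
        using D[OF \<open>u x > 0\<close>, of y] y ratio(1) by (intro mult_left_mono) auto
      finally have "dist z z' \<le> (D + K) * ratio ^ n"
        using z'(2) dist_triangle[of z z' "foldr f \<sigma> y"] by (simp add: algebra_simps)
      moreover have "?Z n z \<le> attractor A K z'"
        using attractor_upper[OF z'(1)] pos Z01 by simp
      ultimately show "\<exists>z'. ?Z n z \<le> attractor A K z' \<and> dist z z' \<le> (D + K) * ratio ^ n"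
        by blast
    qed
  qed
qed

text \<open>
  Membership in a level is witnessed by one seed, so any set containing this seed has an attractor
  that is at least as large at \<open>z\<close>. The same \<open>K\<close> serves both sets.
\<close>

lemma attractor_subset_attained:
  assumes "0 < attractor A K z"
  shows "\<exists>a\<in>A. \<forall>B. a \<in> B \<longrightarrow> attractor A K z \<le> attractor B K z"
proof -
  have "z \<in> attractor_level A K (attractor A K z)"
    using attractor_ge_iff[OF assms, of z] attractor_range[of A K z] by simp
  then obtain a where a: "a \<in> A" "\<And>B. a \<in> B \<Longrightarrow> z \<in> attractor_level B K (attractor A K z)"
    unfolding attractor_level_def by blast
  then show ?thesis
    using attractor_upper attractor_range[of A K z] by (intro bexI[of _ a]) auto
qed

end

section \<open>Restriction to an orbit closure\<close>

lemma (in orbital_fuzzy_ifs) seed_bound_exists: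
  assumes A: "compact A"
  shows "\<exists>K\<ge>0. \<forall>a\<in>A. \<forall>i\<in>I. dist (f i a) a \<le> K * (1 - ratio)"
proof -
  have "compact (\<Union>i\<in>I. (\<lambda>a. dist (f i a) a) ` A)"
    using finite_index A continuous_maps
    by (intro compact_UN compact_continuous_image continuous_intros) (auto intro: continuous_on_subset)
  then have "bdd_above (\<Union>i\<in>I. (\<lambda>a. dist (f i a) a) ` A)"
    by (intro bounded_imp_bdd_above compact_imp_bounded)
  then obtain M where M: "\<And>i a. i \<in> I \<Longrightarrow> a \<in> A \<Longrightarrow> dist (f i a) a \<le> M"
    unfolding bdd_above_def by blast
  have "dist (f i a) a \<le> (\<bar>M\<bar> / (1 - ratio)) * (1 - ratio)" if "i \<in> I" "a \<in> A" for i a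
    using M[OF that] ratio(2) by simp
  moreover have "0 \<le> \<bar>M\<bar> / (1 - ratio)" using ratio(2) by simp
  ultimately show ?thesis by blast
qed

lemma orbit_restrict_fuzzy_compact_usc:
  assumes u: "u \<in> fuzzy_compact_usc" and y: "y \<in> closure (orbit I f w)" "u y = 1"
  shows "orbit_restrict I f u w \<in> fuzzy_compact_usc"
proof -
  let ?v = "orbit_restrict I f u w"
  have "positive_set ?v \<subseteq> positive_set u"
    by (auto simp: positive_set_def orbit_restrict_def split: if_splits)
  then have "compact (closure (positive_set ?v))"
    using fuzzy_compact_usc_support[OF u]
    by (metis closed_closure closure_mono compact_Int_closed inf.absorb_iff2)
  moreover have "closed {x. \<alpha> \<le> ?v x}" for \<alpha>
  proof (cases "\<alpha> \<le> 0")
    case True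
    then have "{x. \<alpha> \<le> ?v x} = UNIV"
      using fuzzy_compact_usc_range[OF u] by (auto simp: orbit_restrict_def intro: order_trans)
    then show ?thesis by simp
  next
    case False
    then have "{x. \<alpha> \<le> ?v x} = {x. \<alpha> \<le> u x} \<inter> closure (orbit I f w)"
      by (auto simp: orbit_restrict_def split: if_splits)
    then show ?thesis
      using u by (auto simp: fuzzy_compact_usc_def upper_semicontinuous_iff_closed)
  qed
  moreover have "range ?v \<subseteq> {0..1}"
    using fuzzy_compact_usc_range[OF u] by (auto simp: orbit_restrict_def)
  moreover have "?v y = 1" using y by (simp add: orbit_restrict_def)
  ultimately show ?thesis
    by (auto simp: fuzzy_compact_usc_def fuzzy_compact_def level_set_def upper_semicontinuous_iff_closed)
qed

text \<open>
  One constant \<open>K\<close> chosen for all of \<open>A\<close> works for the seed sets \<open>A' x\<close> as well, so all limits are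
  attractors with the same parameter and can be compared through their seed sets.
\<close>

theorem theorem3p9:
  fixes I :: "'i set"
    and f :: "'i \<Rightarrow> 'a::complete_space \<Rightarrow> 'a"
    and \<rho> :: "'i \<Rightarrow> real \<Rightarrow> real"
    and u :: "'a \<Rightarrow> real"
    and w y :: "'a \<Rightarrow> 'a"
    and uu :: "'a \<Rightarrow> real"
    and ux :: "'a \<Rightarrow> 'a \<Rightarrow> real"
  assumes "orbital_fuzzy_ifs I f \<rho>"
    and "u \<in> fuzzy_orbital I f"
    and "\<forall>x\<in>positive_set u. x \<in> orbit I f (w x) \<and> y x \<in> orbit I f (w x) \<and> u (y x) = 1"
  defines "uu \<equiv> hutchinson_lim I f \<rho> u"
    and "ux \<equiv> \<lambda>x. hutchinson_lim I f \<rho> (orbit_restrict I f u (w x))"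
  shows "uu = (\<lambda>z. SUP x\<in>positive_set u. ux x z) \<and>
         uu = (\<lambda>z. SUP x\<in>level_set u 1. ux x z) \<and>
         (\<forall>z. \<exists>x\<in>positive_set u. ux x z = (SUP x'\<in>positive_set u. ux x' z)) \<and>
         (\<forall>z. \<exists>x\<in>level_set u 1. ux x z = (SUP x'\<in>level_set u 1. ux x' z))"
proof -
  interpret orbital_fuzzy_ifs I f \<rho> by fact
  have u: "u \<in> fuzzy_compact_usc" using assms(2) by (simp add: fuzzy_orbital_def)
  define A where "A = {x. u x = 1}"
  define A' where "A' = (\<lambda>x. A \<inter> closure (orbit I f (w x)))"
  have level1: "level_set u 1 = A"
    using fuzzy_compact_usc_range(2)[OF u] by (auto simp: level_set_def A_def intro: antisym)
  have A_sub: "A \<subseteq> positive_set u" by (auto simp: A_def positive_set_def)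
  have w: "x \<in> closure (orbit I f (w x))" "y x \<in> closure (orbit I f (w x))" "u (y x) = 1"
    if "x \<in> positive_set u" for x
    using assms(3) that closure_subset by blast+
  have "compact {x. u x \<ge> 1}"
    using fuzzy_compact_usc_levels_compact[OF u] by (simp add: levels_compact_def)
  then have A_compact: "compact A"
    using level1 by (simp add: level_set_def)
  obtain a0 where a0: "a0 \<in> A" using u by (auto simp: fuzzy_compact_usc_def fuzzy_compact_def A_def)
  obtain K where K: "0 \<le> K" "\<And>a i. a \<in> A \<Longrightarrow> i \<in> I \<Longrightarrow> dist (f i a) a \<le> K * (1 - ratio)"
    using seed_bound_exists[OF A_compact] by blast
  interpret seeds: orbital_seeds I f \<rho> A K
    by unfold_locales (use A_compact a0 K in auto)
  have uu: "uu = attractor A K"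
    unfolding uu_def
  proof (rule seeds.hutchinson_lim_eq_attractor[OF u _ A_def])
    fix x assume "u x > 0"
    then have "x \<in> positive_set u" by (simp add: positive_set_def)
    then show "\<exists>w y. x \<in> closure (orbit I f w) \<and> y \<in> closure (orbit I f w) \<and> u y = 1"
      using w by blast
  qed
  have ux: "ux x = attractor (A' x) K" if x: "x \<in> positive_set u" for x
  proof -
    interpret part: orbital_seeds I f \<rho> "A' x" K
    proof unfold_locales
      show "compact (A' x)" unfolding A'_def using A_compact by (intro compact_Int_closed) auto
      show "A' x \<noteq> {}" using w[OF x] by (auto simp: A'_def A_def)
    qed (use K in \<open>auto simp: A'_def\<close>)
    let ?v = "orbit_restrict I f u (w x)"
    show ?thesis
      unfolding ux_def
    proof (rule part.hutchinson_lim_eq_attractor)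
      show "?v \<in> fuzzy_compact_usc"
        using orbit_restrict_fuzzy_compact_usc[OF u w(2,3)[OF x]] .
      show "A' x = {z. ?v z = 1}"
        by (auto simp: A'_def A_def orbit_restrict_def)
      fix t assume "?v t > 0"
      then have "t \<in> closure (orbit I f (w x))" by (auto simp: orbit_restrict_def split: if_splits)
      then show "\<exists>w y. t \<in> closure (orbit I f w) \<and> y \<in> closure (orbit I f w) \<and> ?v y = 1"
        using w[OF x] by (intro exI[of _ "w x"] exI[of _ "y x"]) (auto simp: orbit_restrict_def)
    qed
  qed
  have le: "ux x z \<le> uu z" if "x \<in> positive_set u" for x z
    unfolding uu ux[OF that] by (intro attractor_mono) (simp add: A'_def)
  have attained: "\<exists>x\<in>A. ux x z = uu z" for z
  proof (cases "uu z > 0")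
    case True
    then obtain a where a: "a \<in> A" "\<And>B. a \<in> B \<Longrightarrow> uu z \<le> attractor B K z"
      using seeds.attractor_subset_attained[of z] uu by blast
    have "a \<in> positive_set u" using a(1) A_sub by blast
    moreover have "uu z \<le> attractor (A' a) K z"
      using a w(1)[OF \<open>a \<in> positive_set u\<close>] by (intro a(2)) (simp add: A'_def)
    ultimately show ?thesis using a(1) le[of a z] ux[of a] by (intro bexI[of _ a]) auto
  next
    case False
    have a0': "a0 \<in> positive_set u" using a0 A_sub by blast
    have "0 \<le> ux a0 z" using ux[OF a0'] attractor_range by simp
    then show ?thesis using False le[OF a0', of z] a0 by (intro bexI[of _ a0]) auto
  qed
  have sup: "(SUP x\<in>S. ux x z) = uu z" if "A \<subseteq> S" "S \<subseteq> positive_set u" for S z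
  proof (rule cSup_eq_maximum)
    show "uu z \<in> (\<lambda>x. ux x z) ` S" using attained[of z] that(1) by force
    show "t \<le> uu z" if "t \<in> (\<lambda>x. ux x z) ` S" for t using that le \<open>S \<subseteq> positive_set u\<close> by auto
  qed
  show ?thesis
    unfolding level1 using sup[OF order_refl A_sub] sup[OF A_sub order_refl] attained A_sub
    by (simp add: fun_eq_iff) blast
qed

end
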